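(* Let $P_S>0$, $P_J\geq 0$, $\sigma^2=P_N>0$, and let $M\geq 2$ be a power of $2$. Consider the channel $R=S+e^{j\Theta}J+N$, where $S$ and $J$ are complex random variables with distributions $F_S$ and $F_J$ respectively, $\Theta$ is uniformly distributed on $\{2\pi i/M: i=0,\dots,M-1\}$, $N\sim\mathcal{CN}(0,P_N)$, and $S,J,\Theta,N$ are mutually independent. Write $\phi(F_S,F_J)=I(S;R)$ for the mutual information. Then $$\max_{F_S:\ \mathbb{E}|S|^2\le P_S}\ \min_{F_J:\ \mathbb{E}|J|^2\le P_J}\ \phi(F_S,F_J)=\log\Big(1+\frac{P_S}{P_J+P_N}\Big),$$ and the pair $(F_S^*,F_J^* )=(\mathcal{CN}(0,P_S),\mathcal{CN}(0,P_J))$ is a saddle point: for all $F_S$ with $\mathbb{E}|S|^2\le P_S$ and all $F_J$ with $\mathbb{E}|J|^2\le P_J$, $\phi(F_S,F_J^* )\le\phi(F_S^*,F_J^* )\le\phi(F_S^*,F_J)$, with $\phi(F_S^*,F_J^* )=\log(1+P_S/(P_J+P_N))$.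
   Context: $\mathcal{CN}(0,P)$ denotes the circularly symmetric complex Gaussian distribution with mean $0$ and variance $E|X|^2=P$. The logarithm is taken in a fixed base (base $2$ gives bits per symbol). *)

theory Defs
  imports "HOL-Probability.Probability"
begin

definition complex_gaussian :: "real \<Rightarrow> complex measure" where
  "complex_gaussian P =
     (if P = 0 then return borel 0
      else distr (density lborel (normal_density 0 (sqrt (P / 2)))
                  \<Otimes>\<^sub>M density lborel (normal_density 0 (sqrt (P / 2))))
                 borel (\<lambda>(x, y). Complex x y))"

definition phase_measure :: "nat \<Rightarrow> complex measure" where
  "phase_measure M = distr (measure_pmf (pmf_of_set {..<M})) borel
                       (\<lambda>i. cis (2 * pi * real i / real M))"

definition power_dists :: "real \<Rightarrow> complex measure set" where
  "power_dists P = {F. prob_space F \<and> sets F = sets (borel :: complex measure) \<and>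
       integrable F (\<lambda>z. (cmod z)\<^sup>2) \<and> (\<integral>z. (cmod z)\<^sup>2 \<partial>F) \<le> P}"

definition channel_space ::
  "nat \<Rightarrow> real \<Rightarrow> complex measure \<Rightarrow> complex measure \<Rightarrow> (complex \<times> complex \<times> complex \<times> complex) measure" where
  "channel_space M PN FS FJ = FS \<Otimes>\<^sub>M (FJ \<Otimes>\<^sub>M (phase_measure M \<Otimes>\<^sub>M complex_gaussian PN))"

definition channel_output :: "complex \<times> complex \<times> complex \<times> complex \<Rightarrow> complex" where
  "channel_output = (\<lambda>(s, j, u, n). s + u * j + n)"

definition phi :: "real \<Rightarrow> nat \<Rightarrow> real \<Rightarrow> complex measure \<Rightarrow> complex measure \<Rightarrow> real" where
  "phi b M PN FS FJ =
     prob_space.mutual_information (channel_space M PN FS FJ) b borel borel fst channel_output"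

end

theory Submission
  imports Defs
begin

text \<open>
  Given \<open>S\<close>, the output is \<open>R = S + W\<close> with effective noise \<open>W = e\<^sup>j\<^sup>\<Theta> J + N\<close>, whose density \<open>q\<close>, being a
  Gaussian mixture, lies between a constant and a multiple of \<open>exp (- B \<bar>z\<bar>\<^sup>2)\<close>; hence every logarithm below
  is integrable. Let \<open>f\<close> be the density of \<open>R\<close>, \<open>g\<^sub>P\<close> that of \<open>CN(0, P)\<close>, \<open>Q = P\<^sub>J + P\<^sub>N\<close>
  and \<open>T = P\<^sub>S + Q\<close>. Both saddle point inequalities are instances of Gibbs' inequality.

  For a Gaussian jammer \<open>q = g\<^sub>Q\<close>, and replacing \<open>f\<close> by \<open>g\<^sub>T\<close> can only increase
  \<open>I(S; R) = E log (q W / f R)\<close>. For a Gaussian signal and an arbitrary jammer, the function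
  \<open>f r * g\<^sub>Q (r - s) / g\<^sub>T r\<close> is a probability density with respect to the product of the signal
  law and Lebesgue measure; comparing it with \<open>q (r - s)\<close> gives
  \<open>I(S; R) \<ge> E log (g\<^sub>Q W / g\<^sub>T R)\<close>. In both cases the bound depends only on the second
  moments of \<open>W\<close> and \<open>R\<close>.
\<close>

subsection \<open>The circularly symmetric Gaussian density\<close>

lemma measurable_Complex [measurable]:
  "(\<lambda>(x, y). Complex x y) \<in> borel \<Otimes>\<^sub>M borel \<rightarrow>\<^sub>M borel"
  unfolding Complex_eq by measurable

text \<open>Lebesgue measure is determined by its values on boxes, and a box in the complex plane is
  a product of two real intervals. This carries densities of pairs of real variables over to
  \<open>complex\<close>.\<close>

lemma lborel_complex: "distr (lborel \<Otimes>\<^sub>M lborel) borel (\<lambda>(x, y). Complex x y) = lborel"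
proof (rule lborel_eqI[symmetric])
  fix l u :: complex
  assume le: "\<And>b. b \<in> Basis \<Longrightarrow> l \<bullet> b \<le> u \<bullet> b"
  have le': "Re l \<le> Re u" "Im l \<le> Im u"
    using le[of 1] le[of "\<i>"] by (auto simp: Basis_complex_def)
  have eq: "(\<lambda>(x, y). Complex x y) -` box l u \<inter> space (lborel \<Otimes>\<^sub>M lborel) =
      {Re l<..<Re u} \<times> {Im l<..<Im u}"
    by (auto simp: box_def Basis_complex_def space_pair_measure)
  show "emeasure (distr (lborel \<Otimes>\<^sub>M lborel) borel (\<lambda>(x, y). Complex x y)) (box l u) =
      (\<Prod>b\<in>Basis. (u - l) \<bullet> b)"
    using le'
    by (subst emeasure_distr)
       (auto simp: eq lborel.emeasure_pair_measure_Times Basis_complex_def ennreal_mult)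
qed simp

lemma nn_integral_lborel_complex:
  assumes [measurable]: "f \<in> borel_measurable borel"
  shows "(\<integral>\<^sup>+z. f z \<partial>lborel) = (\<integral>\<^sup>+x. \<integral>\<^sup>+y. f (Complex x y) \<partial>lborel \<partial>lborel)"
proof -
  have [measurable]: "(\<lambda>x. f (Complex (fst x) (snd x))) \<in> borel_measurable (lborel \<Otimes>\<^sub>M lborel)"
    using measurable_compose[OF measurable_Complex assms] by (simp add: case_prod_beta)
  have "(\<integral>\<^sup>+z. f z \<partial>lborel) = (\<integral>\<^sup>+x. f (Complex (fst x) (snd x)) \<partial>(lborel \<Otimes>\<^sub>M lborel))"
    by (subst lborel_complex[symmetric], subst nn_integral_distr) (auto simp: case_prod_beta)
  then show ?thesis
    by (subst (asm) lborel.nn_integral_fst[symmetric]) auto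
qed

text \<open>The Lebesgue density of the circularly symmetric Gaussian law for \<open>P > 0\<close>:
  each coordinate has variance \<open>P / 2\<close>, which cancels the usual 2 in the exponent. For
  \<open>P = 0\<close> division by zero yields the zero function, so the degenerate law is treated
  separately.\<close>

definition gaussian_density :: "real \<Rightarrow> complex \<Rightarrow> real" where
  "gaussian_density P z = exp (- ((cmod z)\<^sup>2 / P)) / (pi * P)"

lemma gaussian_density_measurable [measurable]: "gaussian_density P \<in> borel_measurable borel"
  unfolding gaussian_density_def by measurable

lemma gaussian_density_pos: "P > 0 \<Longrightarrow> 0 < gaussian_density P z"
  by (simp add: gaussian_density_def)

lemma gaussian_density_le: "P > 0 \<Longrightarrow> gaussian_density P z \<le> 1 / (pi * P)"
  by (simp add: gaussian_density_def divide_right_mono)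

text \<open>Circular symmetry; it later absorbs the random phase applied to a Gaussian
  jammer.\<close>

lemma gaussian_density_unit_mult:
  "cmod u = 1 \<Longrightarrow> gaussian_density P (u * z) = gaussian_density P z"
  by (simp add: gaussian_density_def norm_mult)

lemma gaussian_density_Complex:
  assumes "P > 0"
  shows "gaussian_density P (Complex x y) =
    normal_density 0 (sqrt (P / 2)) x * normal_density 0 (sqrt (P / 2)) y"
proof -
  have "exp (- ((x\<^sup>2 + y\<^sup>2) / P)) = exp (- (x\<^sup>2 / P)) * exp (- (y\<^sup>2 / P))"
    by (simp add: exp_add[symmetric] add_divide_distrib)
  with assms show ?thesis
    by (simp add: gaussian_density_def normal_density_def cmod_power2 field_simps)
qed

lemma complex_gaussian_density:
  assumes "P > 0"
  shows "complex_gaussian P = density lborel (gaussian_density P)"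
proof -
  let ?n = "\<lambda>x. ennreal (normal_density 0 (sqrt (P / 2)) x)"
  interpret n: prob_space "density lborel ?n"
    by (rule prob_space_normal_density) (use assms in simp)
  have "complex_gaussian P = distr (density (lborel \<Otimes>\<^sub>M lborel) (\<lambda>(x, y). ?n x * ?n y)) borel (\<lambda>(x, y). Complex x y)"
    using assms n.sigma_finite_measure_axioms
    by (simp add: complex_gaussian_def pair_measure_density lborel.sigma_finite_measure_axioms)
  \<comment> \<open>The product density is a function of \<open>Complex x y\<close>, the form in
    which \<open>density_distr\<close> pushes a density forward.\<close>
  also have "(\<lambda>(x, y). ?n x * ?n y) =
      (\<lambda>p. ennreal (gaussian_density P (case p of (x, y) \<Rightarrow> Complex x y)))"
    using assms by (auto simp: gaussian_density_Complex ennreal_mult fun_eq_iff)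
  also have "distr (density (lborel \<Otimes>\<^sub>M lborel) \<dots>) borel (\<lambda>(x, y). Complex x y) =
      density (distr (lborel \<Otimes>\<^sub>M lborel) borel (\<lambda>(x, y). Complex x y)) (gaussian_density P)"
    by (rule density_distr[symmetric]) auto
  finally show ?thesis
    by (simp add: lborel_complex)
qed

lemma sets_complex_gaussian [measurable_cong, simp]: "sets (complex_gaussian P) = sets borel"
  by (simp add: complex_gaussian_def)

lemma prob_space_complex_gaussian:
  assumes "P \<ge> 0"
  shows "prob_space (complex_gaussian P)"
proof (cases "P = 0")
  case False
  interpret n: prob_space "density lborel (normal_density 0 (sqrt (P / 2)))"
    by (rule prob_space_normal_density) (use assms False in simp)
  interpret n2: pair_prob_space "density lborel (normal_density 0 (sqrt (P / 2)))"
    "density lborel (normal_density 0 (sqrt (P / 2)))" ..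
  show ?thesis
    using False by (auto simp: complex_gaussian_def intro!: n2.prob_space_distr)
qed (simp add: complex_gaussian_def prob_space_return)

text \<open>Real and imaginary coordinates separate, and each is a convolution of centred real
  normals with variances \<open>P / 2\<close> and \<open>Q / 2\<close>.\<close>

lemma gaussian_density_convolution:
  assumes "P > 0" "Q > 0"
  shows "(\<integral>\<^sup>+w. ennreal (gaussian_density P w) * ennreal (gaussian_density Q (z - w)) \<partial>lborel) =
    gaussian_density (P + Q) z"
proof -
  let ?n = "\<lambda>P. normal_density 0 (sqrt (P / 2))"
  have conv: "(\<integral>\<^sup>+y. ennreal (?n Q (x - y) * ?n P y) \<partial>lborel) = ?n (P + Q) x" for x
    using conv_normal_density_zero_mean[of "sqrt (Q / 2)" "sqrt (P / 2)"] assms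
    by (simp add: fun_eq_iff add_divide_distrib[symmetric] add.commute)
  have "(\<integral>\<^sup>+w. ennreal (gaussian_density P w) * ennreal (gaussian_density Q (z - w)) \<partial>lborel) =
     (\<integral>\<^sup>+x. \<integral>\<^sup>+y. ennreal (?n Q (Re z - x) * ?n P x) * ennreal (?n Q (Im z - y) * ?n P y) \<partial>lborel \<partial>lborel)"
  proof (subst nn_integral_lborel_complex, measurable, intro nn_integral_cong)
    fix x y
    have "z - Complex x y = Complex (Re z - x) (Im z - y)"
      by (simp add: complex_eq_iff)
    then show "ennreal (gaussian_density P (Complex x y)) * ennreal (gaussian_density Q (z - Complex x y)) =
        ennreal (?n Q (Re z - x) * ?n P x) * ennreal (?n Q (Im z - y) * ?n P y)"
      using assms by (simp add: gaussian_density_Complex ennreal_mult[symmetric] ac_simps)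
  qed
  also have "\<dots> = ennreal (?n (P + Q) (Re z)) * ennreal (?n (P + Q) (Im z))"
    by (simp add: nn_integral_cmult nn_integral_multc conv)
  also have "\<dots> = gaussian_density (P + Q) z"
    using assms gaussian_density_Complex[of "P + Q" "Re z" "Im z"] by (simp add: ennreal_mult)
  finally show ?thesis .
qed

subsection \<open>Second moments and densities of independent sums\<close>

lemma (in pair_prob_space) distr_snd: "distr (M1 \<Otimes>\<^sub>M M2) M2 snd = M2"
proof (rule measure_eqI)
  fix A assume "A \<in> sets (distr (M1 \<Otimes>\<^sub>M M2) M2 snd)"
  then have A: "A \<in> sets M2" by simp
  then have "snd -` A \<inter> space (M1 \<Otimes>\<^sub>M M2) = space M1 \<times> A"
    using sets.sets_into_space[OF A] by (auto simp: space_pair_measure)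
  with A show "emeasure (distr (M1 \<Otimes>\<^sub>M M2) M2 snd) A = emeasure M2 A"
    by (simp add: emeasure_distr M2.emeasure_pair_measure_Times M1.emeasure_space_1)
qed simp

lemma (in pair_prob_space)
  fixes f :: "_ \<Rightarrow> 'c::{banach, second_countable_topology}"
  assumes "integrable M1 f"
  shows integrable_comp_fst: "integrable (M1 \<Otimes>\<^sub>M M2) (\<lambda>p. f (fst p))"
    and integral_comp_fst: "(\<integral>p. f (fst p) \<partial>(M1 \<Otimes>\<^sub>M M2)) = (\<integral>x. f x \<partial>M1)"
proof -
  have f: "f \<in> borel_measurable M1" using assms by simp
  show "integrable (M1 \<Otimes>\<^sub>M M2) (\<lambda>p. f (fst p))"
    using assms integrable_distr_eq[OF measurable_fst f, of M2] by (simp add: M2.distr_pair_fst)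
  show "(\<integral>p. f (fst p) \<partial>(M1 \<Otimes>\<^sub>M M2)) = (\<integral>x. f x \<partial>M1)"
    using integral_distr[OF measurable_fst f, of M2] by (simp add: M2.distr_pair_fst)
qed

lemma (in pair_prob_space)
  fixes f :: "_ \<Rightarrow> 'c::{banach, second_countable_topology}"
  assumes "integrable M2 f"
  shows integrable_comp_snd: "integrable (M1 \<Otimes>\<^sub>M M2) (\<lambda>p. f (snd p))"
    and integral_comp_snd: "(\<integral>p. f (snd p) \<partial>(M1 \<Otimes>\<^sub>M M2)) = (\<integral>x. f x \<partial>M2)"
proof -
  have f: "f \<in> borel_measurable M2" using assms by simp
  show "integrable (M1 \<Otimes>\<^sub>M M2) (\<lambda>p. f (snd p))"
    using assms integrable_distr_eq[OF measurable_snd f, of M1] by (simp add: distr_snd)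
  show "(\<integral>p. f (snd p) \<partial>(M1 \<Otimes>\<^sub>M M2)) = (\<integral>x. f x \<partial>M2)"
    using integral_distr[OF measurable_snd f, of M1] by (simp add: distr_snd)
qed

lemma (in finite_measure) integrable_of_square_integrable:
  fixes f :: "'a \<Rightarrow> complex"
  assumes [measurable]: "f \<in> borel_measurable M" and "integrable M (\<lambda>x. (cmod (f x))\<^sup>2)"
  shows "integrable M f"
proof (rule Bochner_Integration.integrable_bound[of _ "\<lambda>x. 1 + (cmod (f x))\<^sup>2"])
  show "AE x in M. norm (f x) \<le> norm (1 + (cmod (f x))\<^sup>2)"
  proof (intro AE_I2)
    fix x
    \<comment> \<open>Nonnegativity of \<open>(cmod (f x) - 1)\<^sup>2\<close> bounds even
      \<open>2 * cmod (f x)\<close> by the right side.\<close>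
    have "cmod (f x) \<le> 1 + (cmod (f x))\<^sup>2"
      using zero_le_power2[of "cmod (f x) - 1"] unfolding power2_diff by (simp, smt (verit) norm_ge_zero)
    then show "norm (f x) \<le> norm (1 + (cmod (f x))\<^sup>2)" by simp
  qed
qed (use assms in auto)

lemma cmod_add_squared: "(cmod (x + y))\<^sup>2 = (cmod x)\<^sup>2 + (cmod y)\<^sup>2 + 2 * (x \<bullet> y)"
  by (simp add: power2_norm_eq_inner inner_add_left inner_add_right inner_commute)

text \<open>In the expanded square the cross term is integrable by Cauchy-Schwarz, and by Fubini its
  integral is the inner product of the two means. One vanishing mean is enough, so the other summand
  may be an arbitrary signal or jammer.\<close>

lemma
  assumes "prob_space X" "prob_space Y"
    and [measurable_cong]: "sets X = sets borel" "sets Y = sets borel"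
    and X2: "integrable X (\<lambda>z. (cmod z)\<^sup>2)" and Y2: "integrable Y (\<lambda>z. (cmod z)\<^sup>2)"
  shows integrable_cmod_add_squared:
      "integrable (X \<Otimes>\<^sub>M Y) (\<lambda>p. (cmod (fst p + snd p))\<^sup>2)" (is ?int)
    and integral_cmod_add_squared:
      "(\<integral>x. x \<partial>X) = 0 \<or> (\<integral>y. y \<partial>Y) = 0 \<Longrightarrow>
       (\<integral>p. (cmod (fst p + snd p))\<^sup>2 \<partial>(X \<Otimes>\<^sub>M Y)) = (\<integral>z. (cmod z)\<^sup>2 \<partial>X) + (\<integral>z. (cmod z)\<^sup>2 \<partial>Y)"
proof -
  interpret X: prob_space X by fact
  interpret Y: prob_space Y by fact
  interpret pair_prob_space X Y ..
  note 1 = integrable_comp_fst[OF X2] integral_comp_fst[OF X2]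
  note 2 = integrable_comp_snd[OF Y2] integral_comp_snd[OF Y2]
  have ix: "integrable X (\<lambda>x. x)" and iy: "integrable Y (\<lambda>y. y)"
    using X2 Y2 by (auto intro!: X.integrable_of_square_integrable Y.integrable_of_square_integrable)
  have inn: "integrable (X \<Otimes>\<^sub>M Y) (\<lambda>p. fst p \<bullet> snd p)"
  proof (rule Bochner_Integration.integrable_bound)
    show "integrable (X \<Otimes>\<^sub>M Y) (\<lambda>p. (cmod (fst p))\<^sup>2 + (cmod (snd p))\<^sup>2)"
      using 1 2 by auto
    show "AE p in X \<Otimes>\<^sub>M Y. norm (fst p \<bullet> snd p) \<le> norm ((cmod (fst p))\<^sup>2 + (cmod (snd p))\<^sup>2)"
    proof (intro AE_I2)
      fix p :: "complex \<times> complex"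
      have "\<bar>fst p \<bullet> snd p\<bar> \<le> cmod (fst p) * cmod (snd p)" by (rule Cauchy_Schwarz_ineq2)
      also have "\<dots> \<le> (cmod (fst p))\<^sup>2 + (cmod (snd p))\<^sup>2"
        using sum_squares_bound[of "cmod (fst p)" "cmod (snd p)"]
          mult_nonneg_nonneg[OF norm_ge_zero norm_ge_zero, of "fst p" "snd p"] by linarith
      finally show "norm (fst p \<bullet> snd p) \<le> norm ((cmod (fst p))\<^sup>2 + (cmod (snd p))\<^sup>2)" by simp
    qed
  qed measurable
  show ?int
    unfolding cmod_add_squared using 1 2 inn by auto
  assume z: "(\<integral>x. x \<partial>X) = 0 \<or> (\<integral>y. y \<partial>Y) = 0"
  have "(\<integral>p. fst p \<bullet> snd p \<partial>(X \<Otimes>\<^sub>M Y)) = (\<integral>x. \<integral>y. x \<bullet> y \<partial>Y \<partial>X)"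
    using integral_fst'[of "\<lambda>p. fst p \<bullet> snd p"] inn by simp
  also have "\<dots> = (\<integral>x. x \<partial>X) \<bullet> (\<integral>y. y \<partial>Y)"
    using ix iy by simp
  finally show "(\<integral>p. (cmod (fst p + snd p))\<^sup>2 \<partial>(X \<Otimes>\<^sub>M Y)) = (\<integral>z. (cmod z)\<^sup>2 \<partial>X) + (\<integral>z. (cmod z)\<^sup>2 \<partial>Y)"
    unfolding cmod_add_squared using 1 2 inn z by auto
qed

text \<open>Each coordinate has mean zero and second moment \<open>P / 2\<close>; for
  \<open>P = 0\<close> the law is the point mass at the origin.\<close>

lemma
  assumes "P \<ge> 0"
  shows integrable_complex_gaussian_cmod_squared: "integrable (complex_gaussian P) (\<lambda>z. (cmod z)\<^sup>2)"
    and integral_complex_gaussian_cmod_squared: "(\<integral>z. (cmod z)\<^sup>2 \<partial>complex_gaussian P) = P"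
    and integral_complex_gaussian: "(\<integral>z. z \<partial>complex_gaussian P) = 0"
proof -
  have "integrable (complex_gaussian P) (\<lambda>z. (cmod z)\<^sup>2) \<and> (\<integral>z. (cmod z)\<^sup>2 \<partial>complex_gaussian P) = P \<and>
    (\<integral>z. z \<partial>complex_gaussian P) = 0"
  proof (cases "P = 0")
    case True
    then show ?thesis
      by (auto simp: complex_gaussian_def integral_return integrable_iff_bounded nn_integral_return)
  next
    case False
    then have P: "P > 0" using assms by simp
    define n where "n = density lborel (normal_density 0 (sqrt (P / 2)))"
    have [measurable_cong]: "sets n = sets borel" by (simp add: n_def)
    interpret n: prob_space n
      unfolding n_def by (rule prob_space_normal_density) (use P in simp)
    interpret pair_prob_space n n ..
    have cg: "complex_gaussian P = distr (n \<Otimes>\<^sub>M n) borel (\<lambda>(x, y). Complex x y)"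
      using False by (simp add: complex_gaussian_def n_def)
    have 1: "integrable n (\<lambda>x. x)" "(\<integral>x. x \<partial>n) = 0"
      using integrable_normal_moment_nz_1[of "sqrt (P / 2)" 0]
          integral_normal_moment_nz_1[of "sqrt (P / 2)" 0] P
      by (auto simp: n_def integrable_density integral_density normal_density_nonneg)
    have 2: "integrable n (\<lambda>x. x\<^sup>2)" "(\<integral>x. x\<^sup>2 \<partial>n) = P / 2"
      using integrable_normal_moment[of "sqrt (P / 2)" 0 2]
          integral_normal_moment_even[of "sqrt (P / 2)" 0 1] P
      by (auto simp: n_def integrable_density integral_density normal_density_nonneg)
    note m1 = integrable_comp_fst[OF 1(1)] integrable_comp_snd[OF 1(1)] integral_comp_fst[OF 1(1)]
        integral_comp_snd[OF 1(1)]
    note m2 = integrable_comp_fst[OF 2(1)] integrable_comp_snd[OF 2(1)] integral_comp_fst[OF 2(1)]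
        integral_comp_snd[OF 2(1)]
    have i2: "integrable (complex_gaussian P) (\<lambda>z. (cmod z)\<^sup>2)"
      unfolding cg using m2 by (subst integrable_distr_eq) (auto simp: case_prod_beta cmod_power2)
    interpret cg: prob_space "complex_gaussian P" by (rule prob_space_complex_gaussian[OF assms])
    have i1: "integrable (complex_gaussian P) (\<lambda>z. z)"
      by (rule cg.integrable_of_square_integrable) (use i2 in auto)
    have "(\<integral>z. (cmod z)\<^sup>2 \<partial>complex_gaussian P) = P"
      unfolding cg using m2 2 by (subst integral_distr) (auto simp: case_prod_beta cmod_power2)
    moreover have "Re (\<integral>z. z \<partial>complex_gaussian P) = 0"
    proof -
      have "Re (\<integral>z. z \<partial>complex_gaussian P) = (\<integral>z. Re z \<partial>complex_gaussian P)"
        by (rule integral_Re[OF i1, symmetric])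
      also have "\<dots> = (\<integral>p. fst p \<partial>(n \<Otimes>\<^sub>M n))"
        unfolding cg by (subst integral_distr) (simp_all add: case_prod_beta)
      also have "\<dots> = 0" using m1(3) 1(2) by simp
      finally show ?thesis .
    qed
    moreover have "Im (\<integral>z. z \<partial>complex_gaussian P) = 0"
    proof -
      have "Im (\<integral>z. z \<partial>complex_gaussian P) = (\<integral>z. Im z \<partial>complex_gaussian P)"
        by (rule integral_Im[OF i1, symmetric])
      also have "\<dots> = (\<integral>p. snd p \<partial>(n \<Otimes>\<^sub>M n))"
        unfolding cg by (subst integral_distr) (simp_all add: case_prod_beta)
      also have "\<dots> = 0" using m1(4) 1(2) by simp
      finally show ?thesis .
    qed
    ultimately show ?thesis
      using i2 by (auto simp: complex_eq_iff)
  qed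
  then show "integrable (complex_gaussian P) (\<lambda>z. (cmod z)\<^sup>2)" "(\<integral>z. (cmod z)\<^sup>2 \<partial>complex_gaussian P) = P"
    "(\<integral>z. z \<partial>complex_gaussian P) = 0" by auto
qed

lemma complex_gaussian_in_power_dists: "P \<ge> 0 \<Longrightarrow> complex_gaussian P \<in> power_dists P"
  by (simp add: power_dists_def prob_space_complex_gaussian integrable_complex_gaussian_cmod_squared
      integral_complex_gaussian_cmod_squared)

section \<open>Densities of sums of independent variables\<close>

lemma nn_integral_lborel_translate:
  fixes c :: "'a::euclidean_space"
  assumes [measurable]: "f \<in> borel_measurable borel"
  shows "(\<integral>\<^sup>+x. f (c + x) \<partial>lborel) = (\<integral>\<^sup>+x. f x \<partial>lborel)"
  by (subst (2) lborel_distr_plus[of c, symmetric], subst nn_integral_distr) auto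

text \<open>For fixed \<open>s\<close> the sum is a translate of the noise, and Lebesgue measure is
  translation invariant. Taking \<open>X\<close> itself as the base measure in the first coordinate
  covers inputs without a density.\<close>

lemma distr_sum_joint:
  fixes q :: "complex \<Rightarrow> ennreal"
  assumes "sets X = sets borel"
    and [measurable]: "q \<in> borel_measurable borel"
    and "prob_space (density lborel q)"
  shows "distr (X \<Otimes>\<^sub>M density lborel q) (borel \<Otimes>\<^sub>M borel) (\<lambda>(s, w). (s, s + w)) =
    density (X \<Otimes>\<^sub>M lborel) (\<lambda>(s, r). q (r - s))"
proof (rule measure_eqI)
  note [measurable_cong] = assms(1)
  interpret q: prob_space "density lborel q" by fact
  fix A assume "A \<in> sets (distr (X \<Otimes>\<^sub>M density lborel q) (borel \<Otimes>\<^sub>M borel) (\<lambda>(s, w). (s, s + w)))"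
  then have [measurable]: "A \<in> sets (borel \<Otimes>\<^sub>M borel)" by simp
  then have [measurable]: "A \<in> sets (X \<Otimes>\<^sub>M lborel)"
    by (simp cong: sets_pair_measure_cong add: assms(1))
  have "emeasure (distr (X \<Otimes>\<^sub>M density lborel q) (borel \<Otimes>\<^sub>M borel) (\<lambda>(s, w). (s, s + w))) A =
      (\<integral>\<^sup>+p. indicator A (fst p, fst p + snd p) \<partial>(X \<Otimes>\<^sub>M density lborel q))"
    by (subst nn_integral_indicator[symmetric], simp, subst nn_integral_distr)
        (auto simp: case_prod_beta)
  also have "\<dots> = (\<integral>\<^sup>+s. \<integral>\<^sup>+w. q w * indicator A (s, s + w) \<partial>lborel \<partial>X)"
    by (subst q.nn_integral_fst[symmetric]) (auto intro!: nn_integral_cong simp: nn_integral_density)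
  also have "\<dots> = (\<integral>\<^sup>+s. \<integral>\<^sup>+r. q (r - s) * indicator A (s, r) \<partial>lborel \<partial>X)"
  proof (rule nn_integral_cong)
    fix s assume [measurable]: "s \<in> space X"
    show "(\<integral>\<^sup>+w. q w * indicator A (s, s + w) \<partial>lborel) = (\<integral>\<^sup>+r. q (r - s) * indicator A (s, r) \<partial>lborel)"
      by (subst nn_integral_lborel_translate[of _ s, symmetric]) auto
  qed
  also have "\<dots> = emeasure (density (X \<Otimes>\<^sub>M lborel) (\<lambda>(s, r). q (r - s))) A"
    by (simp add: emeasure_density lborel.nn_integral_fst[symmetric] case_prod_beta)
  finally show "emeasure (distr (X \<Otimes>\<^sub>M density lborel q) (borel \<Otimes>\<^sub>M borel) (\<lambda>(s, w). (s, s + w))) A =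
     emeasure (density (X \<Otimes>\<^sub>M lborel) (\<lambda>(s, r). q (r - s))) A" .
qed (auto simp: assms(1) intro!: sets_pair_measure_cong)

text \<open>The second marginal of \<open>distr_sum_joint\<close>, with \<open>s\<close> integrated
  out by Tonelli.\<close>

lemma distr_sum_density:
  fixes q :: "complex \<Rightarrow> ennreal"
  assumes "prob_space X" "sets X = sets borel"
    and [measurable]: "q \<in> borel_measurable borel"
    and "prob_space (density lborel q)"
  shows "distr (X \<Otimes>\<^sub>M density lborel q) borel (\<lambda>(s, w). s + w) =
    density lborel (\<lambda>r. \<integral>\<^sup>+s. q (r - s) \<partial>X)"
proof (rule measure_eqI)
  note [measurable_cong] = assms(2)
  interpret X: prob_space X by fact
  interpret pair_sigma_finite X lborel ..
  fix A assume "A \<in> sets (distr (X \<Otimes>\<^sub>M density lborel q) borel (\<lambda>(s, w). s + w))"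
  then have [measurable]: "A \<in> sets borel" by simp
  have "distr (X \<Otimes>\<^sub>M density lborel q) borel (\<lambda>(s, w). s + w) =
      distr (density (X \<Otimes>\<^sub>M lborel) (\<lambda>(s, r). q (r - s))) borel snd"
    by (subst distr_sum_joint[symmetric, OF assms(2-4)], subst distr_distr)
        (auto simp: comp_def split_beta')
  then have "emeasure (distr (X \<Otimes>\<^sub>M density lborel q) borel (\<lambda>(s, w). s + w)) A =
      (\<integral>\<^sup>+p. q (snd p - fst p) * indicator A (snd p) \<partial>(X \<Otimes>\<^sub>M lborel))"
    by (simp add: nn_integral_indicator[symmetric] nn_integral_distr nn_integral_density case_prod_beta
        del: nn_integral_indicator)
  also have "\<dots> = (\<integral>\<^sup>+r. \<integral>\<^sup>+s. q (r - s) * indicator A r \<partial>X \<partial>lborel)"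
    by (subst nn_integral_snd[symmetric]) auto
  also have "\<dots> = emeasure (density lborel (\<lambda>r. \<integral>\<^sup>+s. q (r - s) \<partial>X)) A"
    by (simp add: emeasure_density nn_integral_multc)
  finally show "emeasure (distr (X \<Otimes>\<^sub>M density lborel q) borel (\<lambda>(s, w). s + w)) A =
    emeasure (density lborel (\<lambda>r. \<integral>\<^sup>+s. q (r - s) \<partial>X)) A" .
qed simp

subsection \<open>Mutual information of an additive noise channel\<close>

text \<open>Later \<open>t\<close> is a multiple of the squared modulus, so that a finite second
  moment makes the logarithm of a density integrable.\<close>

lemma abs_ln_bound:
  fixes x :: real
  assumes "0 < c" "0 \<le> t" "c * exp (- t) \<le> x" "x \<le> K"
  shows "\<bar>ln x\<bar> \<le> \<bar>ln c\<bar> + \<bar>ln K\<bar> + t"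
proof -
  have "0 < c * exp (- t)" using assms by simp
  then have "0 < x" using assms by linarith
  then have "ln x \<le> ln K" using assms by simp
  moreover have "ln c - t \<le> ln x"
  proof -
    have "ln c - t = ln (c * exp (- t))" using assms by (simp add: ln_mult)
    also have "\<dots> \<le> ln x" using assms \<open>0 < x\<close> by simp
    finally show ?thesis .
  qed
  ultimately show ?thesis using \<open>0 \<le> t\<close> by linarith
qed

text \<open>Used twice: first with the rotated jammer as input and thermal noise as noise, then with
  the signal as input and the output density of the first channel as noise density. The bounds
  \<open>q_ge\<close> and \<open>q_le\<close> control all logarithms and pass to the output density
  with \<open>B\<close> doubled.\<close>

locale additive_noise = X: prob_space X for X :: "complex measure" +
  fixes q :: "complex \<Rightarrow> real" and c B K :: real
  assumes sets_X [measurable_cong, simp]: "sets X = sets borel"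
    and q_measurable [measurable]: "q \<in> borel_measurable borel"
    and prob_space_q: "prob_space (density lborel q)"
    and c_pos: "0 < c" and B_nonneg: "0 \<le> B"
    and q_ge: "c * exp (- (B * (cmod z)\<^sup>2)) \<le> q z"
    and q_le: "q z \<le> K"
    and X_square: "integrable X (\<lambda>z. (cmod z)\<^sup>2)"
    and q_square: "integrable (density lborel q) (\<lambda>z. (cmod z)\<^sup>2)"
begin

definition "W = density lborel q"

definition "f r = (\<integral>s. q (r - s) \<partial>X)"

text \<open>\<open>KL_divergence\<close> takes its reference measure first, so this is the
  divergence of the joint law of input and output from the product of the marginals.\<close>

definition "mutual_info b =
  KL_divergence b (X \<Otimes>\<^sub>M distr (X \<Otimes>\<^sub>M W) borel (\<lambda>(s, w). s + w))
    (distr (X \<Otimes>\<^sub>M W) (borel \<Otimes>\<^sub>M borel) (\<lambda>(s, w). (s, s + w)))"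

lemma sets_W [measurable_cong, simp]: "sets W = sets borel"
  by (simp add: W_def)

sublocale W: prob_space W
  unfolding W_def by (rule prob_space_q)

sublocale pair_prob_space X W ..

section \<open>Bounds on the noise and output densities\<close>

lemma q_pos: "0 < q z"
  using q_ge[of z] c_pos by (smt (verit) exp_gt_zero mult_pos_pos)

lemma integrable_q: "integrable X (\<lambda>s. q (r - s))"
  using q_le q_pos by (intro X.integrable_const_bound[where B=K]) (auto simp: less_imp_le)

lemma f_measurable [measurable]: "f \<in> borel_measurable borel"
  unfolding f_def by measurable

lemma f_nn: "(\<integral>\<^sup>+s. q (r - s) \<partial>X) = f r"
  unfolding f_def using integrable_q q_pos
  by (intro nn_integral_eq_integral) (auto simp: less_imp_le)

lemma f_le: "f r \<le> K"
  unfolding f_def using integrable_q q_le by (intro X.integral_le_const) auto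

text \<open>The constant in the Gaussian lower bound for \<open>f\<close>: the part of the bound on
  \<open>q (r - s)\<close> that depends on \<open>s\<close>, averaged over the input.\<close>

definition "c' = c * (\<integral>s. exp (- (2 * B * (cmod s)\<^sup>2)) \<partial>X)"

lemma integrable_exp_square: "integrable X (\<lambda>s. exp (- (2 * B * (cmod s)\<^sup>2)))"
  using B_nonneg by (intro X.integrable_const_bound[where B=1]) auto

lemma c'_pos: "0 < c'"
proof -
  have "0 < (\<integral>s. exp (- (2 * B * (cmod s)\<^sup>2)) \<partial>X)"
    using X.integral_less_AE_space[of "\<lambda>_. 0", OF _ integrable_exp_square] X.emeasure_space_1 by simp
  then show ?thesis using c_pos by (simp add: c'_def)
qed

lemma f_ge: "c' * exp (- (2 * B * (cmod r)\<^sup>2)) \<le> f r"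
proof -
  have "c * (exp (- (2 * B * (cmod s)\<^sup>2)) * exp (- (2 * B * (cmod r)\<^sup>2))) \<le> q (r - s)" for s
  proof -
    \<comment> \<open>Bounding the squared modulus of \<open>r - s\<close> by twice the sum of the
      squared moduli splits the Gaussian lower bound into a factor in \<open>r\<close> and a factor
      in \<open>s\<close>, at the price of doubling \<open>B\<close>.\<close>
    have "(cmod (r - s))\<^sup>2 \<le> (cmod r + cmod s)\<^sup>2"
      by (intro power_mono norm_triangle_ineq4) auto
    also have "\<dots> \<le> 2 * (cmod r)\<^sup>2 + 2 * (cmod s)\<^sup>2"
      using sum_squares_bound[of "cmod r" "cmod s"] by (simp add: power2_sum)
    finally have "B * (cmod (r - s))\<^sup>2 \<le> B * (2 * (cmod r)\<^sup>2 + 2 * (cmod s)\<^sup>2)"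
      using B_nonneg by (rule mult_left_mono)
    then have "exp (- (2 * B * (cmod s)\<^sup>2)) * exp (- (2 * B * (cmod r)\<^sup>2)) \<le>
        exp (- (B * (cmod (r - s))\<^sup>2))"
      by (simp add: exp_add[symmetric] algebra_simps)
    then show ?thesis
      using q_ge[of "r - s"] c_pos by (smt (verit) mult_left_mono)
  qed
  then have "(\<integral>s. c * (exp (- (2 * B * (cmod s)\<^sup>2)) * exp (- (2 * B * (cmod r)\<^sup>2))) \<partial>X) \<le> f r"
    unfolding f_def using integrable_exp_square integrable_q by (intro integral_mono) auto
  then show ?thesis by (simp add: c'_def ac_simps)
qed

lemma f_pos: "0 < f z"
  using f_ge[of z] c'_pos by (smt (verit) exp_gt_zero mult_pos_pos)

section \<open>Laws of the output and of the input-output pair\<close>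

lemma distr_sum: "distr (X \<Otimes>\<^sub>M W) borel (\<lambda>(s, w). s + w) = density lborel f"
  unfolding W_def using prob_space_q
  by (subst distr_sum_density) (auto simp: X.prob_space_axioms f_nn)

lemma prob_space_f: "prob_space (density lborel f)"
  unfolding distr_sum[symmetric] by (rule prob_space_distr) simp

lemma distr_joint: "distr (X \<Otimes>\<^sub>M W) (borel \<Otimes>\<^sub>M borel) (\<lambda>(s, w). (s, s + w)) =
    density (X \<Otimes>\<^sub>M lborel) (\<lambda>p. q (snd p - fst p))"
  unfolding W_def using prob_space_q by (subst distr_sum_joint) (auto simp: split_beta')

lemma prob_space_joint: "prob_space (density (X \<Otimes>\<^sub>M lborel) (\<lambda>p. q (snd p - fst p)))"
  unfolding distr_joint[symmetric] by (rule prob_space_distr) simp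

text \<open>The substitution \<open>r = s + w\<close> links two views: divergences are computed with
  densities, whereas moments and logarithms are handled as expectations over the independent pair of
  input and noise.\<close>

lemma
  fixes h :: "complex \<times> complex \<Rightarrow> real"
  assumes [measurable]: "h \<in> borel_measurable (borel \<Otimes>\<^sub>M borel)"
  shows integrable_joint: "integrable (X \<Otimes>\<^sub>M lborel) (\<lambda>p. q (snd p - fst p) * h p) \<longleftrightarrow>
      integrable (X \<Otimes>\<^sub>M W) (\<lambda>p. h (fst p, fst p + snd p))"
    and integral_joint: "(\<integral>p. q (snd p - fst p) * h p \<partial>(X \<Otimes>\<^sub>M lborel)) =
      (\<integral>p. h (fst p, fst p + snd p) \<partial>(X \<Otimes>\<^sub>M W))"
proof -
  have h: "h \<in> borel_measurable (X \<Otimes>\<^sub>M lborel)" by measurable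
  have "integrable (X \<Otimes>\<^sub>M lborel) (\<lambda>p. q (snd p - fst p) * h p) \<longleftrightarrow>
      integrable (density (X \<Otimes>\<^sub>M lborel) (\<lambda>p. q (snd p - fst p))) h"
    using q_pos h by (subst integrable_density) (auto simp: less_imp_le)
  also have "\<dots> \<longleftrightarrow> integrable (X \<Otimes>\<^sub>M W) (\<lambda>p. h (fst p, fst p + snd p))"
    unfolding distr_joint[symmetric] by (subst integrable_distr_eq) (auto simp: split_beta')
  finally show "integrable (X \<Otimes>\<^sub>M lborel) (\<lambda>p. q (snd p - fst p) * h p) \<longleftrightarrow>
      integrable (X \<Otimes>\<^sub>M W) (\<lambda>p. h (fst p, fst p + snd p))" .
  have "(\<integral>p. q (snd p - fst p) * h p \<partial>(X \<Otimes>\<^sub>M lborel)) =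
      (\<integral>p. h p \<partial>density (X \<Otimes>\<^sub>M lborel) (\<lambda>p. q (snd p - fst p)))"
    using q_pos h by (subst integral_density) (auto simp: less_imp_le)
  also have "\<dots> = (\<integral>p. h (fst p, fst p + snd p) \<partial>(X \<Otimes>\<^sub>M W))"
    unfolding distr_joint[symmetric] by (subst integral_distr) (auto simp: split_beta')
  finally show "(\<integral>p. q (snd p - fst p) * h p \<partial>(X \<Otimes>\<^sub>M lborel)) =
      (\<integral>p. h (fst p, fst p + snd p) \<partial>(X \<Otimes>\<^sub>M W))" .
qed

lemma
  fixes h :: "complex \<Rightarrow> real"
  assumes [measurable]: "h \<in> borel_measurable borel"
  shows integrable_output: "integrable lborel (\<lambda>r. f r * h r) \<longleftrightarrow>
      integrable (X \<Otimes>\<^sub>M W) (\<lambda>p. h (fst p + snd p))"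
    and integral_output: "(\<integral>r. f r * h r \<partial>lborel) = (\<integral>p. h (fst p + snd p) \<partial>(X \<Otimes>\<^sub>M W))"
proof -
  have h: "h \<in> borel_measurable lborel" by measurable
  have "integrable lborel (\<lambda>r. f r * h r) \<longleftrightarrow> integrable (density lborel f) h"
    using f_pos h by (subst integrable_density) (auto simp: less_imp_le)
  also have "\<dots> \<longleftrightarrow> integrable (X \<Otimes>\<^sub>M W) (\<lambda>p. h (fst p + snd p))"
    unfolding distr_sum[symmetric] by (subst integrable_distr_eq) (auto simp: split_beta')
  finally show "integrable lborel (\<lambda>r. f r * h r) \<longleftrightarrow>
      integrable (X \<Otimes>\<^sub>M W) (\<lambda>p. h (fst p + snd p))" .
  have "(\<integral>r. f r * h r \<partial>lborel) = (\<integral>r. h r \<partial>density lborel f)"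
    using f_pos h by (subst integral_density) (auto simp: less_imp_le)
  also have "\<dots> = (\<integral>p. h (fst p + snd p) \<partial>(X \<Otimes>\<^sub>M W))"
    unfolding distr_sum[symmetric] by (subst integral_distr) (auto simp: split_beta')
  finally show "(\<integral>r. f r * h r \<partial>lborel) = (\<integral>p. h (fst p + snd p) \<partial>(X \<Otimes>\<^sub>M W))" .
qed

lemma product_output: "X \<Otimes>\<^sub>M density lborel f = density (X \<Otimes>\<^sub>M lborel) (\<lambda>p. f (snd p))"
proof -
  interpret D: prob_space "density lborel f" by (rule prob_space_f)
  \<comment> \<open>\<open>X\<close> is written as a density over itself so that
    \<open>pair_measure_density\<close> applies.\<close>
  have "density X (\<lambda>_. 1) \<Otimes>\<^sub>M density lborel f = density (X \<Otimes>\<^sub>M lborel) (\<lambda>(x, y). 1 * ennreal (f y))"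
    by (intro pair_measure_density D.sigma_finite_measure_axioms lborel.sigma_finite_measure_axioms) auto
  then show ?thesis by (simp add: density_1 split_beta')
qed

lemma mutual_info_KL: "mutual_info b =
  KL_divergence b (density (X \<Otimes>\<^sub>M lborel) (\<lambda>p. f (snd p)))
    (density (X \<Otimes>\<^sub>M lborel) (\<lambda>p. q (snd p - fst p)))"
  by (simp add: mutual_info_def distr_sum distr_joint product_output)

lemma prob_space_product_output: "prob_space (density (X \<Otimes>\<^sub>M lborel) (\<lambda>p. f (snd p)))"
proof -
  interpret D: prob_space "density lborel f" by (rule prob_space_f)
  interpret XD: pair_prob_space X "density lborel f" ..
  show ?thesis unfolding product_output[symmetric] by (rule XD.prob_space_axioms)
qed

lemma W_square: "integrable W (\<lambda>z. (cmod z)\<^sup>2)"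
  using q_square by (simp add: W_def)

lemma integrable_output_square: "integrable (X \<Otimes>\<^sub>M W) (\<lambda>p. (cmod (fst p + snd p))\<^sup>2)"
  by (intro integrable_cmod_add_squared X.prob_space_axioms W.prob_space_axioms sets_X sets_W X_square W_square)

section \<open>Mutual information as an expectation of log densities, and Gibbs bounds\<close>

lemma integrable_log_noise: "integrable (X \<Otimes>\<^sub>M W) (\<lambda>p. log b (q (snd p)))"
proof -
  have "integrable W (\<lambda>w. ln (q w))"
  proof (rule Bochner_Integration.integrable_bound)
    \<comment> \<open>The dominating function comes from \<open>abs_ln_bound\<close> with
      \<open>t = B * (cmod w)\<^sup>2\<close>.\<close>
    show "integrable W (\<lambda>w. \<bar>ln c\<bar> + \<bar>ln K\<bar> + B * (cmod w)\<^sup>2)"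
      using W_square by simp
    show "AE w in W. norm (ln (q w)) \<le> norm (\<bar>ln c\<bar> + \<bar>ln K\<bar> + B * (cmod w)\<^sup>2)"
      using abs_ln_bound[OF c_pos _ q_ge q_le] B_nonneg by (auto intro!: AE_I2)
  qed measurable
  from integrable_comp_snd[OF this] show ?thesis by (simp add: log_def)
qed

lemma integrable_log_output: "integrable (X \<Otimes>\<^sub>M W) (\<lambda>p. log b (f (fst p + snd p)))"
proof -
  have "integrable (X \<Otimes>\<^sub>M W) (\<lambda>p. ln (f (fst p + snd p)))"
  proof (rule Bochner_Integration.integrable_bound)
    show "integrable (X \<Otimes>\<^sub>M W) (\<lambda>p. \<bar>ln c'\<bar> + \<bar>ln K\<bar> + 2 * B * (cmod (fst p + snd p))\<^sup>2)"
      using integrable_output_square by simp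
    show "AE p in X \<Otimes>\<^sub>M W. norm (ln (f (fst p + snd p))) \<le>
        norm (\<bar>ln c'\<bar> + \<bar>ln K\<bar> + 2 * B * (cmod (fst p + snd p))\<^sup>2)"
      using abs_ln_bound[OF c'_pos _ f_ge f_le] B_nonneg by (auto intro!: AE_I2)
  qed measurable
  then show ?thesis by (simp add: log_def)
qed

lemma log_ratio: "log b (q w / f r) = log b (q w) - log b (f r)"
  using q_pos[of w] f_pos[of r] by (simp add: log_def ln_div diff_divide_distrib)

lemma integrable_log_ratio:
  "integrable (X \<Otimes>\<^sub>M lborel) (\<lambda>p. q (snd p - fst p) * log b (q (snd p - fst p) / f (snd p)))"
  by (subst integrable_joint)
     (auto simp: log_ratio intro!: Bochner_Integration.integrable_diff integrable_log_noise integrable_log_output)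

lemma pair_lborel_sigma_finite: "sigma_finite_measure (X \<Otimes>\<^sub>M (lborel :: complex measure))"
proof -
  interpret P: pair_sigma_finite X "lborel :: complex measure" ..
  show ?thesis ..
qed

lemma mutual_info_eq:
  assumes "b > 1"
  shows "mutual_info b = (\<integral>p. log b (q (snd p) / f (fst p + snd p)) \<partial>(X \<Otimes>\<^sub>M W))"
proof -
  have "mutual_info b = (\<integral>p. q (snd p - fst p) * log b (q (snd p - fst p) / f (snd p)) \<partial>(X \<Otimes>\<^sub>M lborel))"
    unfolding mutual_info_KL using q_pos f_pos assms
    by (intro sigma_finite_measure.KL_density_density[OF pair_lborel_sigma_finite])
       (auto simp: less_imp_le less_imp_neq[symmetric])
  then show ?thesis by (subst (asm) integral_joint) auto
qed

lemma mutual_info_nonneg: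
  assumes "b > 1"
  shows "0 \<le> mutual_info b"
  unfolding mutual_info_KL using q_pos f_pos assms integrable_log_ratio prob_space_joint prob_space_product_output
  by (intro sigma_finite_measure.KL_density_density_nonneg[OF pair_lborel_sigma_finite])
     (auto simp: less_imp_le less_imp_neq[symmetric])

text \<open>\<open>g\<close> acts as a trial noise density and \<open>h\<close> as the output
  density it would produce. The gap between the two sides is the divergence of the true joint law
  from the density \<open>k\<close>, because \<open>log (q / k)\<close> equals
  \<open>log (q / f) - log (g / h)\<close>.\<close>

lemma mutual_info_ge:
  fixes g h :: "complex \<Rightarrow> real"
  assumes b: "b > 1"
    and [measurable]: "g \<in> borel_measurable borel" "h \<in> borel_measurable borel"
    and pos: "\<And>z. 0 < g z" "\<And>z. 0 < h z"
    and conv: "\<And>r. (\<integral>\<^sup>+s. g (r - s) \<partial>X) = h r"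
    and int: "integrable (X \<Otimes>\<^sub>M W) (\<lambda>p. log b (g (snd p) / h (fst p + snd p)))"
  shows "(\<integral>p. log b (g (snd p) / h (fst p + snd p)) \<partial>(X \<Otimes>\<^sub>M W)) \<le> mutual_info b"
proof -
  let ?P = "X \<Otimes>\<^sub>M (lborel :: complex measure)"
  \<comment> \<open>Bayes' rule: \<open>g (r - s) / h r\<close> is the conditional density, relative
    to \<open>X\<close>, of the input given the output under the trial noise; it is weighted with
    the true output density \<open>f\<close>.\<close>
  define k where "k p = f (snd p) * g (snd p - fst p) / h (snd p)" for p
  have [measurable]: "k \<in> borel_measurable (borel \<Otimes>\<^sub>M borel)"
    unfolding k_def by measurable
  interpret P: pair_sigma_finite X "lborel :: complex measure" ..
  have kpos: "0 < k p" for p using pos f_pos by (simp add: k_def)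
  have split: "log b (q w * h r / (f r * g w)) = log b (q w / f r) - log b (g w / h r)" for w r
    using pos[of w] pos[of r] q_pos[of w] f_pos[of r]
    by (simp add: log_def ln_div ln_mult diff_divide_distrib[symmetric])
  have int_ratio: "integrable (X \<Otimes>\<^sub>M W) (\<lambda>p. log b (q (snd p) / f (fst p + snd p)))"
    unfolding log_ratio using integrable_log_noise integrable_log_output by simp
  \<comment> \<open>With \<open>s\<close> integrated first, \<open>conv\<close> cancels
    \<open>h r\<close>, and only the total mass of \<open>f\<close> remains.\<close>
  have "(\<integral>\<^sup>+p. ennreal (k p) \<partial>?P) = (\<integral>\<^sup>+r. \<integral>\<^sup>+s. ennreal (f r / h r) * ennreal (g (r - s)) \<partial>X \<partial>lborel)"
    using pos f_pos by (subst P.nn_integral_snd[symmetric])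
      (auto simp: k_def ennreal_mult[symmetric] less_imp_le intro!: nn_integral_cong)
  also have "\<dots> = (\<integral>\<^sup>+r. ennreal (f r) \<partial>lborel)"
    using pos f_pos by (intro nn_integral_cong, subst nn_integral_cmult)
      (auto simp: conv ennreal_mult[symmetric] less_imp_le less_imp_neq[symmetric])
  also have "\<dots> = emeasure (density lborel f) UNIV"
    by (simp add: emeasure_density)
  also have "\<dots> = 1"
    using prob_space.emeasure_space_1[OF prob_space_f] by simp
  finally have k1: "(\<integral>\<^sup>+p. ennreal (k p) \<partial>?P) = 1" .
  have prob_k: "prob_space (density ?P k)"
  proof (rule prob_spaceI)
    have "emeasure (density ?P k) (space ?P) = (\<integral>\<^sup>+p. ennreal (k p) * indicator (space ?P) p \<partial>?P)"
      by (rule emeasure_density) measurable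
    then show "emeasure (density ?P k) (space (density ?P k)) = 1"
      using k1 by (simp cong: nn_integral_cong)
  qed
  have int_k: "integrable ?P (\<lambda>p. q (snd p - fst p) * log b (q (snd p - fst p) / k p))"
    using int int_ratio by (subst integrable_joint) (auto simp: k_def split)
  have "0 \<le> KL_divergence b (density ?P k) (density ?P (\<lambda>p. q (snd p - fst p)))"
    by (rule P.KL_density_density_nonneg[OF b _ _ prob_k _ _ prob_space_joint _ int_k])
       (simp_all add: less_imp_le[OF kpos] less_imp_le[OF q_pos] kpos[THEN less_imp_neq, symmetric])
  also have "\<dots> = (\<integral>p. q (snd p - fst p) * log b (q (snd p - fst p) / k p) \<partial>?P)"
    by (rule P.KL_density_density[OF b])
       (simp_all add: less_imp_le[OF kpos] less_imp_le[OF q_pos] kpos[THEN less_imp_neq, symmetric])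
  also have "\<dots> = (\<integral>p. log b (q (snd p) / k (fst p, fst p + snd p)) \<partial>(X \<Otimes>\<^sub>M W))"
    by (subst integral_joint) simp_all
  also have "\<dots> = (\<integral>p. log b (q (snd p) / f (fst p + snd p)) - log b (g (snd p) / h (fst p + snd p)) \<partial>(X \<Otimes>\<^sub>M W))"
    by (simp add: k_def split)
  also have "\<dots> = mutual_info b - (\<integral>p. log b (g (snd p) / h (fst p + snd p)) \<partial>(X \<Otimes>\<^sub>M W))"
    unfolding mutual_info_eq[OF b] using int_ratio int by (rule Bochner_Integration.integral_diff)
  finally show ?thesis by simp
qed

text \<open>The gap is the divergence of the output law from the trial output density
  \<open>h\<close>; the noise term \<open>log q\<close> is common to both sides.\<close>

lemma mutual_info_le:
  fixes h :: "complex \<Rightarrow> real"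
  assumes b: "b > 1"
    and [measurable]: "h \<in> borel_measurable borel"
    and pos: "\<And>z. 0 < h z"
    and prob_h: "prob_space (density lborel h)"
    and int: "integrable (X \<Otimes>\<^sub>M W) (\<lambda>p. log b (h (fst p + snd p)))"
  shows "mutual_info b \<le> (\<integral>p. log b (q (snd p) / h (fst p + snd p)) \<partial>(X \<Otimes>\<^sub>M W))"
proof -
  have split: "log b (x / h r) = log b x - log b (h r)" if "0 < x" for x r
    using pos[of r] that by (simp add: log_def ln_div diff_divide_distrib)
  have int_k: "integrable lborel (\<lambda>r. f r * log b (f r / h r))"
    using int integrable_log_output f_pos by (subst integrable_output) (auto simp: split)
  have "0 \<le> KL_divergence b (density lborel h) (density lborel f)"
    using b pos f_pos prob_h prob_space_f int_k
    by (intro lborel.KL_density_density_nonneg) (auto simp: less_imp_le less_imp_neq[symmetric])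
  also have "\<dots> = (\<integral>r. f r * log b (f r / h r) \<partial>lborel)"
    using b pos f_pos
    by (intro lborel.KL_density_density) (auto simp: less_imp_le less_imp_neq[symmetric])
  also have "\<dots> = (\<integral>p. log b (f (fst p + snd p)) - log b (h (fst p + snd p)) \<partial>(X \<Otimes>\<^sub>M W))"
    using f_pos by (subst integral_output) (auto simp: split)
  finally have "0 \<le> (\<integral>p. log b (f (fst p + snd p)) \<partial>(X \<Otimes>\<^sub>M W)) - (\<integral>p. log b (h (fst p + snd p)) \<partial>(X \<Otimes>\<^sub>M W))"
    using int integrable_log_output by simp
  then show ?thesis
    using b q_pos int integrable_log_output integrable_log_noise
    by (simp add: mutual_info_eq log_ratio split)
qed

end

subsection \<open>The jamming channel\<close>

lemma sets_phase_measure [measurable_cong, simp]: "sets (phase_measure M) = sets borel"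
  by (simp add: phase_measure_def)

lemma prob_space_phase_measure: "prob_space (phase_measure M)"
  unfolding phase_measure_def by (rule prob_space.prob_space_distr)
      (auto intro: measure_pmf.prob_space_axioms)

lemma AE_phase_measure: "AE u in phase_measure M. cmod u = 1"
  unfolding phase_measure_def by (subst AE_distr_iff) auto

definition jammer_law :: "nat \<Rightarrow> complex measure \<Rightarrow> complex measure" where
  "jammer_law M FJ = distr (FJ \<Otimes>\<^sub>M phase_measure M) borel (\<lambda>(j, u). u * j)"

lemma sets_jammer_law [measurable_cong, simp]: "sets (jammer_law M FJ) = sets borel"
  by (simp add: jammer_law_def)

text \<open>The phase has modulus one almost surely, so the rotation preserves the squared modulus
  and with it the power of the jammer.\<close>

lemma
  assumes "FJ \<in> power_dists PJ"
  shows prob_space_jammer_law: "prob_space (jammer_law M FJ)"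
    and integrable_jammer_law: "integrable (jammer_law M FJ) (\<lambda>z. (cmod z)\<^sup>2)"
    and integral_jammer_law: "(\<integral>z. (cmod z)\<^sup>2 \<partial>jammer_law M FJ) \<le> PJ"
proof -
  have [measurable_cong]: "sets FJ =
      sets borel" and J: "integrable FJ (\<lambda>z. (cmod z)\<^sup>2)" "(\<integral>z. (cmod z)\<^sup>2 \<partial>FJ) \<le> PJ"
    using assms by (auto simp: power_dists_def)
  interpret FJ: prob_space FJ using assms by (simp add: power_dists_def)
  interpret U: prob_space "phase_measure M" by (rule prob_space_phase_measure)
  interpret pair_prob_space FJ "phase_measure M" ..
  show "prob_space (jammer_law M FJ)"
    unfolding jammer_law_def by (rule prob_space_distr) simp
  have "AE p in FJ \<Otimes>\<^sub>M phase_measure M. cmod (snd p) = 1"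
    using AE_distrD[OF measurable_snd, of "\<lambda>u. cmod u = 1" FJ "phase_measure M"] AE_phase_measure[of M]
    unfolding distr_snd by blast
  then have AE: "AE p in FJ \<Otimes>\<^sub>M phase_measure M. (cmod (snd p * fst p))\<^sup>2 = (cmod (fst p))\<^sup>2"
    by eventually_elim (simp add: norm_mult)
  have "integrable (FJ \<Otimes>\<^sub>M phase_measure M) (\<lambda>p. (cmod (snd p * fst p))\<^sup>2)"
    by (rule integrable_cong_AE[THEN iffD2, OF _ _ AE integrable_comp_fst[OF J(1)]]) measurable
  then show "integrable (jammer_law M FJ) (\<lambda>z. (cmod z)\<^sup>2)"
    unfolding jammer_law_def by (subst integrable_distr_eq) (auto simp: split_beta')
  have "(\<integral>z. (cmod z)\<^sup>2 \<partial>jammer_law M FJ) = (\<integral>p. (cmod (snd p * fst p))\<^sup>2 \<partial>(FJ \<Otimes>\<^sub>M phase_measure M))"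
    unfolding jammer_law_def by (subst integral_distr) (auto simp: split_beta')
  also have "\<dots> = (\<integral>p. (cmod (fst p))\<^sup>2 \<partial>(FJ \<Otimes>\<^sub>M phase_measure M))"
    using AE by (intro integral_cong_AE) auto
  also have "\<dots> \<le> PJ"
    using integral_comp_fst[OF J(1)] J(2) by simp
  finally show "(\<integral>z. (cmod z)\<^sup>2 \<partial>jammer_law M FJ) \<le> PJ" .
qed

text \<open>With these constants \<open>q_ge\<close> is an equality, and \<open>q_le\<close> bounds
  the density by its peak at the origin.\<close>

lemma additive_noise_gaussian:
  assumes "prob_space X" "sets X = sets borel" "integrable X (\<lambda>z. (cmod z)\<^sup>2)" "P > 0"
  shows "additive_noise X (gaussian_density P) (1 / (pi * P)) (1 / P) (1 / (pi * P))"
proof (intro additive_noise.intro additive_noise_axioms.intro)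
  show "prob_space (density lborel (gaussian_density P))"
    using prob_space_complex_gaussian[of P] \<open>P > 0\<close> by (simp add: complex_gaussian_density)
  show "integrable (density lborel (gaussian_density P)) (\<lambda>z. (cmod z)\<^sup>2)"
    using integrable_complex_gaussian_cmod_squared[of P] \<open>P > 0\<close> by (simp add: complex_gaussian_density)
  show "1 / (pi * P) * exp (- (1 / P * (cmod z)\<^sup>2)) \<le> gaussian_density P z" for z
    by (simp add: gaussian_density_def)
  show "gaussian_density P z \<le> 1 / (pi * P)" for z
    using \<open>P > 0\<close> by (rule gaussian_density_le)
qed (use assms in simp_all)

text \<open>Fubini turns both laws into the same iterated integral over jammer, phase and thermal
  noise. The regrouping presents the effective noise as the output of an additive channel fed by the
  rotated jammer.\<close>

lemma distr_jammer_noise: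
  assumes "FJ \<in> power_dists PJ" "PN \<ge> 0"
  shows "distr (FJ \<Otimes>\<^sub>M (phase_measure M \<Otimes>\<^sub>M complex_gaussian PN)) borel (\<lambda>(j, u, n). u * j + n) =
    distr (jammer_law M FJ \<Otimes>\<^sub>M complex_gaussian PN) borel (\<lambda>(v, n). v + n)" (is "?L = ?R")
proof (rule measure_eqI)
  have [measurable_cong]: "sets FJ = sets borel" using assms by (simp add: power_dists_def)
  interpret FJ: prob_space FJ using assms by (simp add: power_dists_def)
  interpret U: prob_space "phase_measure M" by (rule prob_space_phase_measure)
  interpret G: prob_space "complex_gaussian PN" by (rule prob_space_complex_gaussian[OF assms(2)])
  interpret UG: pair_prob_space "phase_measure M" "complex_gaussian PN" ..
  fix A assume "A \<in> sets ?L"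
  then have [measurable]: "A \<in> sets borel" by simp
  have "emeasure ?L A = (\<integral>\<^sup>+p. indicator A (fst (snd p) * fst p + snd (snd p)) \<partial>(FJ \<Otimes>\<^sub>M (phase_measure M \<Otimes>\<^sub>M complex_gaussian PN)))"
    by (subst nn_integral_indicator[symmetric], simp, subst nn_integral_distr) (auto simp: split_beta')
  also have "\<dots> = (\<integral>\<^sup>+j. \<integral>\<^sup>+u. \<integral>\<^sup>+n. indicator A (u * j + n) \<partial>complex_gaussian PN \<partial>phase_measure M \<partial>FJ)"
    by (subst UG.nn_integral_fst[symmetric], measurable, intro nn_integral_cong, subst G.nn_integral_fst[symmetric]) auto
  also have "\<dots> = (\<integral>\<^sup>+p. \<integral>\<^sup>+n. indicator A (snd p * fst p + n) \<partial>complex_gaussian PN \<partial>(FJ \<Otimes>\<^sub>M phase_measure M))"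
    by (subst U.nn_integral_fst[symmetric]) auto
  also have "\<dots> = (\<integral>\<^sup>+v. \<integral>\<^sup>+n. indicator A (v + n) \<partial>complex_gaussian PN \<partial>jammer_law M FJ)"
    unfolding jammer_law_def by (subst nn_integral_distr) (auto simp: split_beta')
  also have "\<dots> = (\<integral>\<^sup>+p. indicator A (fst p + snd p) \<partial>(jammer_law M FJ \<Otimes>\<^sub>M complex_gaussian PN))"
    by (subst G.nn_integral_fst[symmetric]) auto
  also have "\<dots> = emeasure ?R A"
    by (subst nn_integral_indicator[symmetric], simp, subst nn_integral_distr) (auto simp: split_beta')
  finally show "emeasure ?L A = emeasure ?R A" .
qed simp

text \<open>Mutual information depends only on the joint law of input and output and on its
  marginals, all of which are images of the law \<open>T\<close> of signal and effective noise. The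
  nested channel space thereby drops out.\<close>

lemma phi_eq_KL:
  fixes FS FJ :: "complex measure" and M :: nat and PN :: real
  defines "T \<equiv> FS \<Otimes>\<^sub>M distr (jammer_law M FJ \<Otimes>\<^sub>M complex_gaussian PN) borel (\<lambda>(v, n). v + n)"
  assumes FS: "FS \<in> power_dists PS" and FJ: "FJ \<in> power_dists PJ" and PN: "PN \<ge> 0"
  shows "phi b M PN FS FJ =
    KL_divergence b (FS \<Otimes>\<^sub>M distr T borel (\<lambda>(s, w). s + w))
      (distr T (borel \<Otimes>\<^sub>M borel) (\<lambda>(s, w). (s, s + w)))"
proof -
  have [measurable_cong]: "sets FJ = sets borel" using FJ by (simp add: power_dists_def)
  have sets_FS [measurable_cong]: "sets FS = sets borel" using FS by (simp add: power_dists_def)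
  interpret FS: prob_space FS using FS by (simp add: power_dists_def)
  interpret FJ: prob_space FJ using FJ by (simp add: power_dists_def)
  interpret U: prob_space "phase_measure M" by (rule prob_space_phase_measure)
  interpret G: prob_space "complex_gaussian PN" by (rule prob_space_complex_gaussian[OF PN])
  interpret UG: pair_prob_space "phase_measure M" "complex_gaussian PN" ..
  interpret JUG: pair_prob_space FJ "phase_measure M \<Otimes>\<^sub>M complex_gaussian PN" ..
  interpret C: pair_prob_space FS "FJ \<Otimes>\<^sub>M (phase_measure M \<Otimes>\<^sub>M complex_gaussian PN)" ..
  let ?N = "FJ \<Otimes>\<^sub>M (phase_measure M \<Otimes>\<^sub>M complex_gaussian PN)"
  let ?w = "\<lambda>(j, u, n). u * j + n :: complex"
  interpret D: prob_space "distr ?N borel ?w"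
    by (rule JUG.prob_space_distr) simp
  \<comment> \<open>\<open>FS\<close> is written as its own image under the identity, so that
    \<open>pair_measure_distr\<close> merges the product of two images into one.\<close>
  have "T = distr FS FS (\<lambda>s. s) \<Otimes>\<^sub>M distr ?N borel ?w"
    unfolding T_def distr_jammer_noise[OF FJ PN] by simp
  also have "\<dots> = distr (FS \<Otimes>\<^sub>M ?N) (FS \<Otimes>\<^sub>M borel) (\<lambda>(x, y). (x, ?w y))"
    by (rule pair_measure_distr) (auto intro: D.sigma_finite_measure_axioms)
  finally have T: "T = distr (FS \<Otimes>\<^sub>M ?N) (FS \<Otimes>\<^sub>M borel) (\<lambda>(x, y). (x, ?w y))" .
  have fst: "distr (FS \<Otimes>\<^sub>M ?N) borel fst = FS"
  proof -
    have "distr (FS \<Otimes>\<^sub>M ?N) borel fst = distr (FS \<Otimes>\<^sub>M ?N) FS fst"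
      by (rule distr_cong) (auto simp: sets_FS)
    then show ?thesis by (simp add: JUG.distr_pair_fst)
  qed
  have out: "distr T borel (\<lambda>(s, w). s + w) = distr (FS \<Otimes>\<^sub>M ?N) borel channel_output"
    unfolding T by (subst distr_distr) (auto simp: channel_output_def comp_def split_beta' ac_simps)
  have joint: "distr T (borel \<Otimes>\<^sub>M borel) (\<lambda>(s, w). (s, s + w)) =
      distr (FS \<Otimes>\<^sub>M ?N) (borel \<Otimes>\<^sub>M borel) (\<lambda>x. (fst x, channel_output x))"
    unfolding T by (subst distr_distr) (auto simp: channel_output_def comp_def split_beta' ac_simps)
  show ?thesis
    unfolding phi_def channel_space_def C.mutual_information_def fst out joint ..
qed

definition noise_density :: "nat \<Rightarrow> real \<Rightarrow> complex measure \<Rightarrow> complex \<Rightarrow> real" where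
  "noise_density M PN FJ z = (\<integral>v. gaussian_density PN (z - v) \<partial>jammer_law M FJ)"

text \<open>All parts come from the locale with the rotated jammer as input and thermal noise as
  noise. The properties of its output density are what the locale requires of the noise in the
  signal channel; the constant \<open>c\<close> is existential because it depends on the
  jammer.\<close>

lemma
  assumes FJ: "FJ \<in> power_dists PJ" and PN: "PN > 0"
  shows distr_noise_density: "distr (jammer_law M FJ \<Otimes>\<^sub>M complex_gaussian PN) borel (\<lambda>(v, n). v + n) =
      density lborel (noise_density M PN FJ)"
    and noise_density_nn: "(\<integral>\<^sup>+v. gaussian_density PN (z - v) \<partial>jammer_law M FJ) =
        noise_density M PN FJ z"
    and integral_noise_square: "(\<integral>z. (cmod z)\<^sup>2 \<partial>density lborel (noise_density M PN FJ)) \<le> PJ + PN"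
    and additive_noise_jammed: "FS \<in> power_dists PS \<Longrightarrow>
      \<exists>c. additive_noise FS (noise_density M PN FJ) c (2 / PN) (1 / (pi * PN))"
proof -
  interpret N: additive_noise "jammer_law M FJ" "gaussian_density PN" "1 / (pi * PN)" "1 / PN" "1 / (pi * PN)"
    by (intro additive_noise_gaussian prob_space_jammer_law integrable_jammer_law sets_jammer_law) fact+
  have f: "N.f = noise_density M PN FJ"
    by (simp add: fun_eq_iff N.f_def noise_density_def)
  have W: "N.W = complex_gaussian PN"
    using PN by (simp add: N.W_def complex_gaussian_density)
  show sum: "distr (jammer_law M FJ \<Otimes>\<^sub>M complex_gaussian PN) borel (\<lambda>(v, n). v + n) =
      density lborel (noise_density M PN FJ)"
    using N.distr_sum by (simp add: f W)
  show "(\<integral>\<^sup>+v. gaussian_density PN (z - v) \<partial>jammer_law M FJ) = noise_density M PN FJ z"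
    using N.f_nn[of z] by (simp add: f)
  have sq: "integrable (density lborel (noise_density M PN FJ)) (\<lambda>z. (cmod z)\<^sup>2)"
    unfolding sum[symmetric] using N.integrable_output_square
    by (subst integrable_distr_eq) (auto simp: W split_beta')
  have "(\<integral>z. (cmod z)\<^sup>2 \<partial>density lborel (noise_density M PN FJ)) =
      (\<integral>p. (cmod (fst p + snd p))\<^sup>2 \<partial>(jammer_law M FJ \<Otimes>\<^sub>M complex_gaussian PN))"
    unfolding sum[symmetric] by (subst integral_distr) (auto simp: split_beta')
  also have "\<dots> = (\<integral>z. (cmod z)\<^sup>2 \<partial>jammer_law M FJ) + PN"
    using PN N.X_square N.W_square N.X.prob_space_axioms N.W.prob_space_axioms
    by (subst integral_cmod_add_squared)
       (auto simp: W integral_complex_gaussian integral_complex_gaussian_cmod_squared)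
  also have "\<dots> \<le> PJ + PN"
    using integral_jammer_law[OF FJ] by simp
  finally show "(\<integral>z. (cmod z)\<^sup>2 \<partial>density lborel (noise_density M PN FJ)) \<le> PJ + PN" .
  assume FS: "FS \<in> power_dists PS"
  have "additive_noise FS (noise_density M PN FJ) N.c' (2 / PN) (1 / (pi * PN))"
    using FS PN N.f_measurable N.f_le N.f_ge N.c'_pos N.prob_space_f sq
    by (intro additive_noise.intro additive_noise_axioms.intro) (simp_all add: power_dists_def f)
  then show "\<exists>c. additive_noise FS (noise_density M PN FJ) c (2 / PN) (1 / (pi * PN))" ..
qed

text \<open>For every fixed phase the rotated Gaussian jammer has the same law, so adding thermal
  noise gives the convolved Gaussian and averaging over the phase changes nothing.\<close>

lemma noise_density_gaussian:
  assumes "PJ \<ge> 0" "PN > 0"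
  shows "noise_density M PN (complex_gaussian PJ) = gaussian_density (PJ + PN)"
proof
  fix z
  interpret FJ: prob_space "complex_gaussian PJ" by (rule prob_space_complex_gaussian) fact
  interpret U: prob_space "phase_measure M" by (rule prob_space_phase_measure)
  interpret pair_prob_space "complex_gaussian PJ" "phase_measure M" ..
  have inner: "(\<integral>\<^sup>+j. gaussian_density PN (z - u * j) \<partial>complex_gaussian PJ) =
      gaussian_density (PJ + PN) z"
    if u: "cmod u = 1" for u
  proof (cases "PJ = 0")
    case True
    then show ?thesis by (simp add: complex_gaussian_def nn_integral_return)
  next
    case False
    then have PJ: "PJ > 0" using assms by simp
    \<comment> \<open>Multiplying the argument by \<open>cnj u\<close>, of modulus one, moves the
      rotation from \<open>j\<close> to \<open>z\<close>; after the convolution, circular symmetry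
      removes it from \<open>z\<close> as well.\<close>
    have "cnj u * u = 1"
      using u by (metis complex_norm_square mult.commute of_real_1 power_one)
    then have "cnj u * (z - u * j) = cnj u * z - j" for j
      by (simp add: right_diff_distrib mult.assoc[symmetric])
    then have rot: "gaussian_density PN (z - u * j) = gaussian_density PN (cnj u * z - j)" for j
      using gaussian_density_unit_mult[of "cnj u" PN "z - u * j"] u by simp
    have "(\<integral>\<^sup>+j. gaussian_density PN (z - u * j) \<partial>complex_gaussian PJ) =
        (\<integral>\<^sup>+j. ennreal (gaussian_density PJ j) * ennreal (gaussian_density PN (cnj u * z - j)) \<partial>lborel)"
      unfolding complex_gaussian_density[OF PJ] rot by (subst nn_integral_density) auto
    also have "\<dots> = gaussian_density (PJ + PN) z"
      using gaussian_density_convolution[OF PJ assms(2)] u by (simp add: gaussian_density_unit_mult)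
    finally show ?thesis .
  qed
  have "ennreal (noise_density M PN (complex_gaussian PJ) z) =
      (\<integral>\<^sup>+v. gaussian_density PN (z - v) \<partial>jammer_law M (complex_gaussian PJ))"
    by (rule noise_density_nn[OF complex_gaussian_in_power_dists, symmetric]) fact+
  also have "\<dots> = (\<integral>\<^sup>+p. gaussian_density PN (z - snd p * fst p) \<partial>(complex_gaussian PJ \<Otimes>\<^sub>M phase_measure M))"
    unfolding jammer_law_def by (subst nn_integral_distr) (auto simp: split_beta')
  also have "\<dots> = (\<integral>\<^sup>+u. \<integral>\<^sup>+j. gaussian_density PN (z - u * j) \<partial>complex_gaussian PJ \<partial>phase_measure M)"
    by (subst nn_integral_snd[symmetric]) auto
  also have "\<dots> = (\<integral>\<^sup>+u. gaussian_density (PJ + PN) z \<partial>phase_measure M)"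
    using AE_phase_measure[of M] by (intro nn_integral_cong_AE) (auto elim!: eventually_mono simp: inner)
  also have "\<dots> = gaussian_density (PJ + PN) z"
    by (simp add: U.emeasure_space_1)
  finally show "noise_density M PN (complex_gaussian PJ) z = gaussian_density (PJ + PN) z"
    using assms gaussian_density_pos[of PN] gaussian_density_pos[of "PJ + PN" z]
    by (subst (asm) ennreal_inj) (auto simp: noise_density_def less_imp_le intro!: integral_nonneg)
qed

section \<open>The two saddle point inequalities and the value of the game\<close>

lemma log_gaussian_ratio:
  assumes "b > 1" "Q > 0" "T > 0"
  shows "log b (gaussian_density Q w / gaussian_density T r) =
    log b (T / Q) + ((cmod r)\<^sup>2 / T - (cmod w)\<^sup>2 / Q) / ln b"
  using assms
  by (simp add: gaussian_density_def log_def ln_div ln_mult add_divide_distrib diff_divide_distrib)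

lemma phi_eq_mutual_info:
  assumes "FS \<in> power_dists PS" "FJ \<in> power_dists PJ" "PN > 0"
  shows "phi b M PN FS FJ = additive_noise.mutual_info FS (noise_density M PN FJ) b"
proof -
  obtain c where "additive_noise FS (noise_density M PN FJ) c (2 / PN) (1 / (pi * PN))"
    using additive_noise_jammed[OF assms(2,3,1)] ..
  then interpret additive_noise FS "noise_density M PN FJ" c "2 / PN" "1 / (pi * PN)" .
  show ?thesis
    using phi_eq_KL[OF assms(1,2)] assms(3)
    by (simp add: mutual_info_def W_def distr_noise_density[OF assms(2,3)])
qed

lemma phi_nonneg:
  assumes "FS \<in> power_dists PS" "FJ \<in> power_dists PJ" "PN > 0" "b > 1"
  shows "0 \<le> phi b M PN FS FJ"
proof -
  obtain c where "additive_noise FS (noise_density M PN FJ) c (2 / PN) (1 / (pi * PN))"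
    using additive_noise_jammed[OF assms(2,3,1)] ..
  then interpret additive_noise FS "noise_density M PN FJ" c "2 / PN" "1 / (pi * PN)" .
  show ?thesis
    using phi_eq_mutual_info[OF assms(1-3)] mutual_info_nonneg[OF assms(4)] by simp
qed

lemma phi_gaussian_jammer_le:
  assumes "b > 1" "PS > 0" "PJ \<ge> 0" "PN > 0" and FS: "FS \<in> power_dists PS"
  shows "phi b M PN FS (complex_gaussian PJ) \<le> log b (1 + PS / (PJ + PN))"
proof -
  define Q where "Q = PJ + PN"
  have Q: "Q > 0" "PS + Q > 0" using assms by (auto simp: Q_def)
  note FJ = complex_gaussian_in_power_dists[OF \<open>PJ \<ge> 0\<close>]
  have q: "noise_density M PN (complex_gaussian PJ) = gaussian_density Q"
    using assms by (simp add: noise_density_gaussian Q_def)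
  obtain c where "additive_noise FS (noise_density M PN (complex_gaussian PJ)) c (2 / PN) (1 / (pi * PN))"
    using additive_noise_jammed[OF FJ \<open>PN > 0\<close> FS] ..
  then interpret additive_noise FS "gaussian_density Q" c "2 / PN" "1 / (pi * PN)" by (simp add: q)
  have W: "W = complex_gaussian Q" using Q by (simp add: W_def complex_gaussian_density)
  \<comment> \<open>The Gaussian noise is centred, so powers add even when the signal has a nonzero
    mean.\<close>
  have r2: "(\<integral>p. (cmod (fst p + snd p))\<^sup>2 \<partial>(FS \<Otimes>\<^sub>M W)) \<le> PS + Q"
    using FS Q X_square W_square X.prob_space_axioms W.prob_space_axioms
    by (subst integral_cmod_add_squared)
       (auto simp: W power_dists_def integral_complex_gaussian integral_complex_gaussian_cmod_squared)
  have w2: "(\<integral>p. (cmod (snd p))\<^sup>2 \<partial>(FS \<Otimes>\<^sub>M W)) = Q"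
    using integral_comp_snd[OF W_square] Q by (simp add: W integral_complex_gaussian_cmod_squared)
  have "integrable (FS \<Otimes>\<^sub>M W) (\<lambda>p. log b (gaussian_density (PS + Q) (fst p + snd p)))"
    using integrable_output_square Q
    by (simp add: gaussian_density_def log_def ln_div ln_mult)
  then have "phi b M PN FS (complex_gaussian PJ) \<le>
      (\<integral>p. log b (gaussian_density Q (snd p) / gaussian_density (PS + Q) (fst p + snd p)) \<partial>(FS \<Otimes>\<^sub>M W))"
    using prob_space_complex_gaussian[of "PS + Q"] Q assms
    by (simp only: phi_eq_mutual_info[OF FS FJ \<open>PN > 0\<close>] q)
       (intro mutual_info_le, auto simp: gaussian_density_pos complex_gaussian_density)
  \<comment> \<open>By \<open>log_gaussian_ratio\<close> the integrand is affine in the squared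
    moduli of output and noise, so second moments determine the integral.\<close>
  also have "\<dots> = log b ((PS + Q) / Q) +
      ((\<integral>p. (cmod (fst p + snd p))\<^sup>2 \<partial>(FS \<Otimes>\<^sub>M W)) / (PS + Q) - Q / Q) / ln b"
    using integrable_output_square integrable_comp_snd[OF W_square] w2 Q assms prob_space
    by (simp add: log_gaussian_ratio)
  \<comment> \<open>By \<open>r2\<close> the first quotient is at most 1, and the second equals 1,
    so the correction is nonpositive.\<close>
  also have "\<dots> \<le> log b ((PS + Q) / Q)"
    using r2 Q assms by (simp add: divide_nonpos_pos)
  also have "(PS + Q) / Q = 1 + PS / Q"
    using Q by (simp add: field_simps)
  finally show ?thesis by (simp add: Q_def)
qed

lemma phi_gaussian_signal_ge:
  assumes "b > 1" "PS > 0" "PJ \<ge> 0" "PN > 0" and FJ: "FJ \<in> power_dists PJ"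
  shows "log b (1 + PS / (PJ + PN)) \<le> phi b M PN (complex_gaussian PS) FJ"
proof -
  define Q where "Q = PJ + PN"
  have Q: "Q > 0" "PS + Q > 0" using assms by (auto simp: Q_def)
  have FS: "complex_gaussian PS \<in> power_dists PS" using assms
      by (simp add: complex_gaussian_in_power_dists)
  obtain c where "additive_noise (complex_gaussian PS) (noise_density M PN FJ) c (2 / PN) (1 / (pi * PN))"
    using additive_noise_jammed[OF FJ \<open>PN > 0\<close> FS] ..
  then interpret additive_noise "complex_gaussian PS" "noise_density M PN FJ" c "2 / PN" "1 / (pi * PN)" .
  define N where "N = (\<integral>z. (cmod z)\<^sup>2 \<partial>W)"
  have N: "N \<le> Q"
    using integral_noise_square[OF FJ \<open>PN > 0\<close>] by (simp add: N_def W_def Q_def)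
  \<comment> \<open>Here the signal is the centred summand, so the jammer may have any mean.\<close>
  have r2: "(\<integral>p. (cmod (fst p + snd p))\<^sup>2 \<partial>(complex_gaussian PS \<Otimes>\<^sub>M W)) = PS + N"
    using assms X_square W_square X.prob_space_axioms W.prob_space_axioms
    by (subst integral_cmod_add_squared)
       (auto simp: N_def integral_complex_gaussian integral_complex_gaussian_cmod_squared)
  have w2: "(\<integral>p. (cmod (snd p))\<^sup>2 \<partial>(complex_gaussian PS \<Otimes>\<^sub>M W)) = N"
    using integral_comp_snd[OF W_square] by (simp add: N_def)
  \<comment> \<open>The trial noise is Gaussian with the full noise budget \<open>Q\<close>,
    whatever power \<open>N\<close> the jammer leaves in the actual noise.\<close>
  have conv: "(\<integral>\<^sup>+s. gaussian_density Q (r - s) \<partial>complex_gaussian PS) =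
      gaussian_density (PS + Q) r" for r
    unfolding complex_gaussian_density[OF \<open>PS > 0\<close>]
    using gaussian_density_convolution[OF \<open>PS > 0\<close> Q(1)] by (subst nn_integral_density) auto
  \<comment> \<open>Adding \<open>PS\<close> to numerator and denominator of a fraction at most 1
    does not decrease it. Hence a jammer below its power budget only raises the lower bound.\<close>
  have "N / Q \<le> (PS + N) / (PS + Q)"
    using mult_left_mono[OF N, of PS] Q assms by (simp add: field_simps)
  then have "0 \<le> ((PS + N) / (PS + Q) - N / Q) / ln b"
    using assms by simp
  moreover have "1 + PS / Q = (PS + Q) / Q"
    using Q by (simp add: field_simps)
  ultimately have "log b (1 + PS / Q) \<le> log b ((PS + Q) / Q) + ((PS + N) / (PS + Q) - N / Q) / ln b"
    by simp
  also have "\<dots> = (\<integral>p. log b (gaussian_density Q (snd p) / gaussian_density (PS + Q) (fst p + snd p)) \<partial>(complex_gaussian PS \<Otimes>\<^sub>M W))"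
    using integrable_output_square integrable_comp_snd[OF W_square] w2 r2 Q assms prob_space
    by (simp add: log_gaussian_ratio)
  also have "\<dots> \<le> mutual_info b"
    using integrable_output_square integrable_comp_snd[OF W_square] Q assms conv
    by (intro mutual_info_ge) (auto simp: gaussian_density_pos log_gaussian_ratio)
  also have "\<dots> = phi b M PN (complex_gaussian PS) FJ"
    by (rule phi_eq_mutual_info[OF FS FJ \<open>PN > 0\<close>, symmetric])
  finally show ?thesis by (simp add: Q_def)
qed

text \<open>A saddle point fixes the value: answering any signal with the Gaussian jammer bounds
  every inner infimum from above by the capacity term, while the Gaussian signal guarantees this
  term against every jammer. The supremum is thus attained at the Gaussian signal.\<close>

theorem theorem3:
  fixes b PS PJ PN :: real and M :: nat
  assumes "b > 1" and "PS > 0" and "PJ \<ge> 0" and "PN > 0"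
    and "M \<ge> 2" and "\<exists>k. M = 2 ^ k"
  shows "(SUP FS \<in> power_dists PS. INF FJ \<in> power_dists PJ. phi b M PN FS FJ)
           = log b (1 + PS / (PJ + PN)) \<and>
         (INF FJ \<in> power_dists PJ. phi b M PN (complex_gaussian PS) FJ)
           = log b (1 + PS / (PJ + PN)) \<and>
         complex_gaussian PS \<in> power_dists PS \<and>
         complex_gaussian PJ \<in> power_dists PJ \<and>
         (\<forall>FS \<in> power_dists PS. \<forall>FJ \<in> power_dists PJ.
           phi b M PN FS (complex_gaussian PJ)
             \<le> phi b M PN (complex_gaussian PS) (complex_gaussian PJ) \<and>
           phi b M PN (complex_gaussian PS) (complex_gaussian PJ)
             \<le> phi b M PN (complex_gaussian PS) FJ) \<and>
         phi b M PN (complex_gaussian PS) (complex_gaussian PJ) = log b (1 + PS / (PJ + PN))"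
proof -
  let ?C = "log b (1 + PS / (PJ + PN))"
  have GS: "complex_gaussian PS \<in> power_dists PS" and GJ: "complex_gaussian PJ \<in> power_dists PJ"
    using assms by (auto intro: complex_gaussian_in_power_dists)
  have le: "phi b M PN FS (complex_gaussian PJ) \<le> ?C" if "FS \<in> power_dists PS" for FS
    by (rule phi_gaussian_jammer_le) fact+
  have ge: "?C \<le> phi b M PN (complex_gaussian PS) FJ" if "FJ \<in> power_dists PJ" for FJ
    by (rule phi_gaussian_signal_ge) fact+
  have eq: "phi b M PN (complex_gaussian PS) (complex_gaussian PJ) = ?C"
    using le[OF GS] ge[OF GJ] by simp
  have INF_le: "(INF FJ \<in> power_dists PJ. phi b M PN FS FJ) \<le> ?C" if "FS \<in> power_dists PS" for FS
  proof -
    \<comment> \<open>A real infimum can be bounded by one of its members only when the set is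
      bounded below; nonnegativity of mutual information gives the bound 0.\<close>
    have "bdd_below (phi b M PN FS ` power_dists PJ)"
      using phi_nonneg[OF that] assms by (intro bdd_belowI2[where m=0]) auto
    then show ?thesis
      by (rule cINF_lower2) (use GJ le[OF that] in auto)
  qed
  have INF_eq: "(INF FJ \<in> power_dists PJ. phi b M PN (complex_gaussian PS) FJ) = ?C"
    using INF_le[OF GS] GJ ge by (intro antisym cINF_greatest) auto
  have "(SUP FS \<in> power_dists PS. INF FJ \<in> power_dists PJ. phi b M PN FS FJ) = ?C"
  proof (rule antisym)
    show "(SUP FS \<in> power_dists PS. INF FJ \<in> power_dists PJ. phi b M PN FS FJ) \<le> ?C"
      using GS INF_le by (intro cSUP_least) auto
    show "?C \<le> (SUP FS \<in> power_dists PS. INF FJ \<in> power_dists PJ. phi b M PN FS FJ)"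
    proof -
      \<comment> \<open>Dually, \<open>INF_le\<close> supplies the upper bound under which the real
        supremum dominates its value at the Gaussian signal.\<close>
      have "bdd_above ((\<lambda>FS. INF FJ \<in> power_dists PJ. phi b M PN FS FJ) ` power_dists PS)"
        by (rule bdd_aboveI2[OF INF_le])
      from cSUP_upper[OF GS this] show ?thesis
        unfolding INF_eq .
    qed
  qed
  moreover have "phi b M PN FS (complex_gaussian PJ) \<le>
      phi b M PN (complex_gaussian PS) (complex_gaussian PJ) \<and>
      phi b M PN (complex_gaussian PS) (complex_gaussian PJ) \<le> phi b M PN (complex_gaussian PS) FJ"
    if "FS \<in> power_dists PS" "FJ \<in> power_dists PJ" for FS FJ
    unfolding eq using le[OF that(1)] ge[OF that(2)] ..
  ultimately show ?thesis
    using INF_eq GS GJ eq by blast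
qed

end
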